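(* Let $X$ be a set. For all $a,b\in\mathcal{P}_X$, there exists $c\in\mathcal{P}_X$ with $a\subseteq c\leq b$ (that is, $a\,(\subseteq\circ\leq)\,b$) if and only if $a\mathbf{k}a\subseteq b\mathbf{k}b$.
   Context: The partition monoid $\mathcal{P}_X$ consists of all set partitions of the disjoint union $X\sqcup X=X_0\cup X_1$ of two copies of $X$. An element $a\in\mathcal{P}_X$ is identified with the graph on $X_0\cup X_1$ in which $\{i,j\}$ is an edge iff $i,j$ lie in the same block of $a$ (a union of cliques). Product: given $a,b\in\mathcal{P}_X$, regard $a$ as a graph on $X_0\cup X_1$ and $b$ as a graph on $X_1\cup X_2$ (with $X_0,X_1,X_2$ pairwise disjoint copies of $X$), and let $\Gamma$ be the union of these graphs on $X_0\cup X_1\cup X_2$; then $ab$ is the partition of $X_0\cup X_2$ (identified with $X\sqcup X$) in which $i,j\in X_0\cup X_2$ are in the same block iff there is a path in $\Gamma$ from $i$ to $j$. Inclusion order: $a\subseteq b$ iff every edge of $a$ is an edge of $b$ (i.e. $a$ refines $b$). The Mitsch order $\leq$ on any semigroup $S$ is: $a\leq b$ iff $a=b$ or there are $x,y\in S$ with $a=ax=bx=yb$; here $S=\mathcal{P}_X$. $\mathbf{k}\in\mathcal{P}_X$ is the universal partition, in which all elements of $X\sqcup X$ are in one block (complete graph on $X\sqcup X$). *)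

theory Defs
  imports "HOL-Library.Disjoint_Sets" "HOL-Algebra.Group"
begin

text \<open>The disjoint union of two copies of \<open>X\<close> is \<open>X <+> X\<close>. A partition is a set of
  nonempty blocks, as in \<^const>\<open>partition_on\<close>.\<close>

text \<open>The graph of a partition, as a symmetric relation. Loops are included, which
  affects neither paths nor inclusions between partitions of the same set.\<close>

definition edges :: "'v set set \<Rightarrow> 'v rel" where
  "edges a = {(i, j). \<exists>B\<in>a. i \<in> B \<and> j \<in> B}"

definition subpart :: "'v set set \<Rightarrow> 'v set set \<Rightarrow> bool" (infix "\<sqsubseteq>\<^sub>e" 50) where
  "a \<sqsubseteq>\<^sub>e b \<longleftrightarrow> edges a \<subseteq> edges b"

text \<open>Three pairwise disjoint copies of the ground set, and the embeddings of
  \<open>X <+> X\<close> onto copies 0 and 1, copies 1 and 2, and copies 0 and 2.\<close>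

datatype 'a layered = L0 'a | L1 'a | L2 'a

definition emb01 :: "'a + 'a \<Rightarrow> 'a layered" where "emb01 = case_sum L0 L1"
definition emb12 :: "'a + 'a \<Rightarrow> 'a layered" where "emb12 = case_sum L1 L2"
definition emb02 :: "'a + 'a \<Rightarrow> 'a layered" where "emb02 = case_sum L0 L2"

definition product_graph :: "('a + 'a) set set \<Rightarrow> ('a + 'a) set set \<Rightarrow> 'a layered rel" where
  "product_graph a b = map_prod emb01 emb01 ` edges a \<union> map_prod emb12 emb12 ` edges b"

definition part_mult ::
    "'a set \<Rightarrow> ('a + 'a) set set \<Rightarrow> ('a + 'a) set set \<Rightarrow> ('a + 'a) set set" where
  "part_mult X a b = (X <+> X) //
     {(i, j). i \<in> X <+> X \<and> j \<in> X <+> X \<and> (emb02 i, emb02 j) \<in> (product_graph a b)\<^sup>*}"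

definition partition_monoid :: "'a set \<Rightarrow> ('a + 'a) set set monoid" where
  "partition_monoid X =
     \<lparr>carrier = {a. partition_on (X <+> X) a},
      mult = part_mult X,
      one = (\<lambda>x. {Inl x, Inr x}) ` X\<rparr>"

text \<open>Removing the empty block only matters for empty \<open>X\<close>, where the sole partition is \<open>{}\<close>.\<close>

definition universal_part :: "'a set \<Rightarrow> ('a + 'a) set set" where
  "universal_part X = {X <+> X} - {{}}"

text \<open>The Mitsch order uses only the carrier and the multiplication, so it makes sense
  for an arbitrary semigroup.\<close>

definition mitsch_le :: "('s, 'm) monoid_scheme \<Rightarrow> 's \<Rightarrow> 's \<Rightarrow> bool" where
  "mitsch_le S a b \<longleftrightarrow> a = b \<or>
     (\<exists>x\<in>carrier S. \<exists>y\<in>carrier S.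
        a = a \<otimes>\<^bsub>S\<^esub> x \<and> a = b \<otimes>\<^bsub>S\<^esub> x \<and> a = y \<otimes>\<^bsub>S\<^esub> b)"

lemma sym_product_graph: "sym (product_graph a b)"
  unfolding product_graph_def edges_def sym_def by auto

lemma partition_on_part_mult: "partition_on (X <+> X) (part_mult X a b)"
  unfolding part_mult_def
proof (rule partition_on_quotient, rule equivI)
  let ?R = "{(i, j). i \<in> X <+> X \<and> j \<in> X <+> X \<and> (emb02 i, emb02 j) \<in> (product_graph a b)\<^sup>*}"
  show "?R \<subseteq> (X <+> X) \<times> (X <+> X)" by auto
  show "refl_on (X <+> X) ?R" by (auto simp: refl_on_def)
  show "sym ?R"
    using sym_rtrancl[OF sym_product_graph[of a b]] by (auto simp: sym_def)
  show "trans ?R" by (auto simp: trans_def intro: rtrancl_trans)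
qed

lemma partition_on_universal_part: "partition_on (X <+> X) (universal_part X)"
  by (auto simp: universal_part_def partition_on_def disjoint_def)

end

theory Submission
  imports Defs
begin

text \<open>Let \<open>T\<close> be the set of vertices of \<open>b\<close> that lie in transversal blocks. All middle
  vertices are joined in the graphs of \<open>b \<cdot> k\<close> and \<open>(b \<cdot> k) \<cdot> b\<close>, whence the edge set of
  \<open>c = bkb\<close> is that of \<open>b\<close> together with \<open>T \<times> T\<close>. A vertex outside \<open>T\<close> has the same block in
  every \<open>c = bx = yb\<close> as in \<open>b\<close>; this gives the forward implication. Conversely \<open>bkb \<le> b\<close>:
  if \<open>T\<close> is empty then \<open>bkb = b\<close>, and otherwise \<open>x = kb\<close> and \<open>y = bk\<close> are witnesses. As
  \<open>a \<subseteq> aka\<close>, one can take \<open>c = bkb\<close>.\<close>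

section \<open>Partitions and their edge relations\<close>

lemma edges_equiv: "partition_on A p \<Longrightarrow> equiv A (edges p)"
  using equiv_partition_on unfolding edges_def .

lemma quotient_edges: "partition_on A p \<Longrightarrow> A // edges p = p"
  unfolding edges_def by (rule partition_on_eq_quotient)

text \<open>Reduces equality of partitions to equality of edge sets, the form in which all products
  are computed below.\<close>

lemma edges_inject:
  assumes "partition_on A p" "partition_on A q" "edges p = edges q"
  shows "p = q"
proof -
  have "p = A // edges p" by (rule quotient_edges[OF assms(1), symmetric])
  also have "\<dots> = q" unfolding assms(3) by (rule quotient_edges[OF assms(2)])
  finally show ?thesis .
qed

lemma edges_sym: "partition_on A p \<Longrightarrow> (u, v) \<in> edges p \<Longrightarrow> (v, u) \<in> edges p"
  by (auto simp: edges_def)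

lemma edges_trans:
  "partition_on A p \<Longrightarrow> (u, v) \<in> edges p \<Longrightarrow> (v, w) \<in> edges p \<Longrightarrow> (u, w) \<in> edges p"
  by (meson edges_equiv equivE transE)

lemma edges_in:
  "partition_on A p \<Longrightarrow> (u, v) \<in> edges p \<Longrightarrow> u \<in> A \<and> v \<in> A"
  by (auto simp: edges_def partition_on_def)

lemma edges_universal_part: "edges (universal_part X) = (X <+> X) \<times> (X <+> X)"
  by (auto simp: edges_def universal_part_def)

text \<open>The converse passage to \<open>quotient_edges\<close>: it lets an edge of a product be
  read as reachability in the product graph.\<close>

lemma edges_quotient:
  assumes "equiv A r"
  shows "edges (A // r) = r"
proof -
  have "sym r" "trans r" "r \<subseteq> A \<times> A" "refl_on A r"
    using assms by (auto elim: equivE)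
  show ?thesis
  proof (intro equalityI subrelI)
    fix i j assume "(i, j) \<in> edges (A // r)"
    then obtain x where "(x, i) \<in> r" "(x, j) \<in> r"
      by (auto simp: edges_def quotient_def)
    with \<open>sym r\<close> \<open>trans r\<close> show "(i, j) \<in> r" by (meson symD transD)
  next
    fix i j assume ij: "(i, j) \<in> r"
    with \<open>r \<subseteq> A \<times> A\<close> have i: "i \<in> A" by auto
    moreover from i \<open>refl_on A r\<close> have "(i, i) \<in> r" by (auto dest: refl_onD)
    ultimately show "(i, j) \<in> edges (A // r)"
      using ij unfolding edges_def by (auto intro!: bexI[of _ "r `` {i}"] quotientI)
  qed
qed

lemma edges_part_mult:
  "edges (part_mult X p q) = {(i, j). i \<in> X <+> X \<and> j \<in> X <+> X \<and>
     (emb02 i, emb02 j) \<in> (product_graph p q)\<^sup>*}" (is "_ = ?R")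
proof -
  have "sym ?R"
    using sym_rtrancl[OF sym_product_graph[of p q]] by (auto simp: sym_def)
  moreover have "trans ?R" by (auto simp: trans_def intro: rtrancl_trans)
  ultimately have "equiv (X <+> X) ?R"
    by (intro equivI) (auto simp: refl_on_def)
  then show ?thesis
    unfolding part_mult_def by (rule edges_quotient)
qed

section \<open>Transversal blocks and paths in the product graph\<close>

definition upper_trans :: "('a + 'a) set set \<Rightarrow> 'a set" where
  "upper_trans p = {x. \<exists>y. (Inl x, Inr y) \<in> edges p}"

definition lower_trans :: "('a + 'a) set set \<Rightarrow> 'a set" where
  "lower_trans p = {y. \<exists>x. (Inl x, Inr y) \<in> edges p}"

text \<open>The sets \<open>upper_trans p\<close> and \<open>lower_trans p\<close> are the domain
  and the codomain of a partition \<open>p\<close>; their disjoint sum is the set of all vertices in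
  blocks that meet both rows.\<close>

definition transversal :: "('a + 'a) set set \<Rightarrow> ('a + 'a) set" where
  "transversal p = upper_trans p <+> lower_trans p"

lemma transversal_mono: "edges p \<subseteq> edges q \<Longrightarrow> transversal p \<subseteq> transversal q"
  by (auto simp: transversal_def upper_trans_def lower_trans_def)

lemma path_left:
  "(u, v) \<in> edges p \<Longrightarrow> (emb01 u, emb01 v) \<in> (product_graph p q)\<^sup>*"
  by (rule r_into_rtrancl) (force simp: product_graph_def)

lemma path_right:
  "(u, v) \<in> edges q \<Longrightarrow> (emb12 u, emb12 v) \<in> (product_graph p q)\<^sup>*"
  by (rule r_into_rtrancl) (force simp: product_graph_def)

text \<open>Serves to show that a path cannot leave the block in which it starts.\<close>

lemma closed_rtrancl:
  assumes "(u, v) \<in> r\<^sup>*" "u \<in> S" "\<And>x y. x \<in> S \<Longrightarrow> (x, y) \<in> r \<Longrightarrow> y \<in> S"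
  shows "v \<in> S"
  using assms(1,2) by (induction rule: rtrancl_induct) (auto intro: assms(3))

text \<open>The block of \<open>Inl x\<close> in \<open>p\<close> has no vertex in the middle layer,
  and edges of \<open>q\<close> touch only layers 1 and 2, so a path from \<open>L0 x\<close> stays
  in this block.\<close>

lemma part_mult_upper_block:
  assumes p: "partition_on (X <+> X) p"
    and x: "x \<notin> upper_trans p" and e: "(Inl x, v) \<in> edges (part_mult X p q)"
  shows "(Inl x, v) \<in> edges p"
proof -
  let ?S = "{L0 y |y. (Inl x, Inl y) \<in> edges p}"
  have "x \<in> X" and path: "(L0 x, emb02 v) \<in> (product_graph p q)\<^sup>*"
    using e by (auto simp: edges_part_mult emb02_def)
  then have "L0 x \<in> ?S"
    using edges_equiv[OF p] by (auto simp: equiv_def refl_on_def)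
  with path have "emb02 v \<in> ?S"
  proof (rule closed_rtrancl)
    fix s t assume "s \<in> ?S" "(s, t) \<in> product_graph p q"
    then show "t \<in> ?S"
      using x
      by (auto simp: product_graph_def emb01_def emb12_def upper_trans_def split: sum.splits
          dest: edges_trans[OF p, of "Inl x"])
  qed
  then show ?thesis
    by (auto simp: emb02_def split: sum.splits)
qed

lemma part_mult_lower_block:
  assumes q: "partition_on (X <+> X) q"
    and x: "x \<notin> lower_trans q" and e: "(Inr x, v) \<in> edges (part_mult X p q)"
  shows "(Inr x, v) \<in> edges q"
proof -
  let ?S = "{L2 y |y. (Inr x, Inr y) \<in> edges q}"
  \<comment> \<open>\<open>lower_trans\<close> records edges from the upper row to the lower one, so
    symmetry is needed to exclude those leaving \<open>Inr x\<close> upwards.\<close>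
  have no_upper: "(Inr x, Inl z) \<notin> edges q" for z
    using x edges_sym[OF q, of "Inr x" "Inl z"] by (auto simp: lower_trans_def)
  have "x \<in> X" and path: "(L2 x, emb02 v) \<in> (product_graph p q)\<^sup>*"
    using e by (auto simp: edges_part_mult emb02_def)
  then have "L2 x \<in> ?S"
    using edges_equiv[OF q] by (auto simp: equiv_def refl_on_def)
  with path have "emb02 v \<in> ?S"
  proof (rule closed_rtrancl)
    fix s t assume "s \<in> ?S" "(s, t) \<in> product_graph p q"
    then show "t \<in> ?S"
      using no_upper
      by (auto simp: product_graph_def emb01_def emb12_def split: sum.splits
          dest: edges_trans[OF q, of "Inr x"])
  qed
  then show ?thesis
    by (auto simp: emb02_def split: sum.splits)
qed

section \<open>Products with a connected middle layer\<close>

definition upper_edges :: "('a + 'a) set set \<Rightarrow> 'a rel" where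
  "upper_edges p = {(x, y). (Inl x, Inl y) \<in> edges p}"

text \<open>\<open>upper_edges\<close> and \<open>lower_edges\<close> give the kernel and the
  cokernel of a partition.\<close>

definition lower_edges :: "('a + 'a) set set \<Rightarrow> 'a rel" where
  "lower_edges p = {(x, y). (Inr x, Inr y) \<in> edges p}"

text \<open>The vertices of \<open>?D\<close> are those attached to the middle layer, which one of
  the factors joins completely; so they are all connected. Every other vertex keeps the block it has
  in its own factor.\<close>

lemma edges_part_mult_connected:
  assumes p: "partition_on (X <+> X) p" and q: "partition_on (X <+> X) q"
    and mid: "X \<times> X \<subseteq> lower_edges p \<or> X \<times> X \<subseteq> upper_edges q"
  shows "edges (part_mult X p q) =
    map_prod Inl Inl ` upper_edges p \<union> map_prod Inr Inr ` lower_edges q \<union>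
    (upper_trans p <+> lower_trans q) \<times> (upper_trans p <+> lower_trans q)"
    (is "?E = ?U \<union> ?L \<union> ?D \<times> ?D")
proof -
  let ?G = "(product_graph p q)\<^sup>*"
  have E: "partition_on (X <+> X) (part_mult X p q)"
    by (rule partition_on_part_mult)
  have block: "(u, v) \<in> ?U \<union> ?L" if uv: "(u, v) \<in> ?E" and u: "u \<notin> ?D" for u v
  proof (cases u)
    case (Inl x)
    with u have x: "x \<notin> upper_trans p" by auto
    have "(Inl x, v) \<in> edges p"
      using part_mult_upper_block[OF p x] uv Inl by blast
    with x Inl show ?thesis
      by (cases v) (auto simp: upper_trans_def upper_edges_def)
  next
    case (Inr x)
    with u have x: "x \<notin> lower_trans q" by auto
    have "(Inr x, v) \<in> edges q"
      using part_mult_lower_block[OF q x] uv Inr by blast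
    with x Inr show ?thesis
      using edges_sym[OF q, of u v]
      by (cases v) (auto simp: lower_trans_def lower_edges_def)
  qed
  have sub: "?E \<subseteq> ?U \<union> ?L \<union> ?D \<times> ?D"
  proof (rule subrelI)
    fix u v assume uv: "(u, v) \<in> ?E"
    \<comment> \<open>A pair outside the square of \<open>?D\<close> has an end outside
      \<open>?D\<close>, but possibly only the second one; \<open>block\<close> is then applied to
      the reversed pair.\<close>
    have vu: "(v, u) \<in> ?E" using edges_sym[OF E uv] .
    have "(u, v) \<in> ?U \<union> ?L" if "(v, u) \<in> ?U \<union> ?L"
      using that by (auto simp: upper_edges_def lower_edges_def
          dest: edges_sym[OF p] edges_sym[OF q])
    then show "(u, v) \<in> ?U \<union> ?L \<union> ?D \<times> ?D"
      using block[OF uv] block[OF vu] by blast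
  qed
  have mid': "(L1 y, L1 z) \<in> ?G" if "y \<in> X" "z \<in> X" for y z
    using mid that path_left[of "Inr y" "Inr z" p q] path_right[of "Inl y" "Inl z" q p]
    by (auto simp: lower_edges_def upper_edges_def emb01_def emb12_def)
  have attach: "v \<in> X <+> X \<and> (\<exists>y\<in>X. (emb02 v, L1 y) \<in> ?G)" if v: "v \<in> ?D" for v
  proof (cases v)
    case (Inl x)
    with v obtain y where e: "(Inl x, Inr y) \<in> edges p" by (auto simp: upper_trans_def)
    then show ?thesis
      using path_left[OF e, of q] edges_in[OF p e] Inl by (auto simp: emb01_def emb02_def)
  next
    case (Inr x)
    with v obtain y where "(Inl y, Inr x) \<in> edges q" by (auto simp: lower_trans_def)
    then have e: "(Inr x, Inl y) \<in> edges q" by (rule edges_sym[OF q])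
    then show ?thesis
      using path_right[OF e, of p] edges_in[OF q e] Inr by (auto simp: emb12_def emb02_def)
  qed
  \<comment> \<open>The path leads from \<open>u\<close> into the middle layer, across it by
    \<open>mid'\<close>, and out to \<open>v\<close>.\<close>
  have "(u, v) \<in> ?E" if u: "u \<in> ?D" and v: "v \<in> ?D" for u v
  proof -
    obtain y z where y: "y \<in> X" "(emb02 u, L1 y) \<in> ?G" and z: "z \<in> X" "(emb02 v, L1 z) \<in> ?G"
      using attach[OF u] attach[OF v] by blast
    have "(L1 z, emb02 v) \<in> ?G"
      using z(2) sym_rtrancl[OF sym_product_graph[of p q]] by (auto dest: symD)
    then have "(emb02 u, emb02 v) \<in> ?G"
      using y mid'[OF y(1) z(1)] by (meson rtrancl_trans)
    then show ?thesis
      using attach[OF u] attach[OF v] by (auto simp: edges_part_mult)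
  qed
  then have D: "?D \<times> ?D \<subseteq> ?E" by auto
  have U: "?U \<subseteq> ?E"
  proof
    fix e assume "e \<in> ?U"
    then obtain x y where e: "e = (Inl x, Inl y)" "(Inl x, Inl y) \<in> edges p"
      by (auto simp: upper_edges_def)
    then show "e \<in> ?E"
      using path_left[OF e(2), of q] edges_in[OF p e(2)]
      by (simp add: edges_part_mult emb01_def emb02_def)
  qed
  have L: "?L \<subseteq> ?E"
  proof
    fix e assume "e \<in> ?L"
    then obtain x y where e: "e = (Inr x, Inr y)" "(Inr x, Inr y) \<in> edges q"
      by (auto simp: lower_edges_def)
    then show "e \<in> ?E"
      using path_right[OF e(2), of p] edges_in[OF q e(2)]
      by (simp add: edges_part_mult emb12_def emb02_def)
  qed
  show ?thesis using sub D U L by (intro equalityI Un_least)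
qed

context
  fixes X :: "'a set" and p q :: "('a + 'a) set set"
  assumes p: "partition_on (X <+> X) p" and q: "partition_on (X <+> X) q"
    and mid: "X \<times> X \<subseteq> lower_edges p \<or> X \<times> X \<subseteq> upper_edges q"
begin

lemma upper_edges_part_mult:
  "upper_edges (part_mult X p q) = upper_edges p \<union> upper_trans p \<times> upper_trans p"
  unfolding upper_edges_def edges_part_mult_connected[OF p q mid] by auto

lemma lower_edges_part_mult:
  "lower_edges (part_mult X p q) = lower_edges q \<union> lower_trans q \<times> lower_trans q"
  unfolding lower_edges_def edges_part_mult_connected[OF p q mid] by auto

text \<open>Edges from the upper row to the lower row come only from the square, and they join
  \<open>upper_trans p\<close> to \<open>lower_trans q\<close>; if the latter is empty there are
  none.\<close>

lemma upper_trans_part_mult: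
  "upper_trans (part_mult X p q) = (if lower_trans q = {} then {} else upper_trans p)"
  unfolding upper_trans_def[of "part_mult X p q"] edges_part_mult_connected[OF p q mid] by auto

lemma lower_trans_part_mult:
  "lower_trans (part_mult X p q) = (if upper_trans p = {} then {} else lower_trans q)"
  unfolding lower_trans_def[of "part_mult X p q"] edges_part_mult_connected[OF p q mid] by auto

end

section \<open>Products with the universal partition\<close>

lemma universal_part_simps [simp]:
  "upper_edges (universal_part X) = X \<times> X" "lower_edges (universal_part X) = X \<times> X"
  "upper_trans (universal_part X) = X" "lower_trans (universal_part X) = X"
  by (auto simp: upper_edges_def lower_edges_def upper_trans_def lower_trans_def
      edges_universal_part)

lemma upper_trans_empty_iff: "upper_trans p = {} \<longleftrightarrow> lower_trans p = {}"
  by (auto simp: upper_trans_def lower_trans_def)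

lemma upper_trans_subset: "partition_on (X <+> X) p \<Longrightarrow> upper_trans p \<subseteq> X"
  using edges_in by (fastforce simp: upper_trans_def)

lemma lower_trans_subset: "partition_on (X <+> X) p \<Longrightarrow> lower_trans p \<subseteq> X"
  using edges_in by (fastforce simp: lower_trans_def)

text \<open>An edge between the two rows has both ends in \<open>transversal p\<close>, so the
  square already contains it.\<close>

lemma edges_Un_transversal:
  assumes "partition_on A p"
  shows "edges p \<union> transversal p \<times> transversal p =
    map_prod Inl Inl ` upper_edges p \<union> map_prod Inr Inr ` lower_edges p \<union>
    transversal p \<times> transversal p" (is "?l = ?r")
proof
  show "?r \<subseteq> ?l" by (auto simp: upper_edges_def lower_edges_def)
  show "?l \<subseteq> ?r"
  proof
    fix e assume e: "e \<in> ?l"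
    obtain u v where uv: "e = (u, v)" by (cases e)
    show "e \<in> ?r"
      using e edges_sym[OF assms, of u v] unfolding uv
      by (cases u; cases v)
        (auto simp: transversal_def upper_trans_def lower_trans_def
          upper_edges_def lower_edges_def)
  qed
qed

text \<open>A first product enlarges the kernel by a square over the domain; the larger square of
  the next product swallows it.\<close>

lemma upper_square_absorb:
  "map_prod Inl Inl ` (U \<union> A \<times> A) \<union> L \<union> (A <+> B) \<times> (A <+> B) =
    map_prod Inl Inl ` U \<union> L \<union> (A <+> B) \<times> (A <+> B)"
  unfolding image_Un by (intro equalityI Un_least subsetI) auto

lemma lower_square_absorb:
  "U \<union> map_prod Inr Inr ` (L \<union> B \<times> B) \<union> (A <+> B) \<times> (A <+> B) =
    U \<union> map_prod Inr Inr ` L \<union> (A <+> B) \<times> (A <+> B)"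
  unfolding image_Un by (intro equalityI Un_least subsetI) auto

text \<open>Bracketed to the left, as the infix product in the theorem is.\<close>

abbreviation sandwich :: "'a set \<Rightarrow> ('a + 'a) set set \<Rightarrow> ('a + 'a) set set" where
  "sandwich X p \<equiv> part_mult X (part_mult X p (universal_part X)) p"

text \<open>The formula for a connected middle layer applies twice: first through the upper row of
  \<open>?k\<close>, then through the lower row of the product of \<open>p\<close> and
  \<open>?k\<close>.\<close>

lemma edges_sandwich:
  assumes p: "partition_on (X <+> X) p"
  shows "edges (sandwich X p) = edges p \<union> transversal p \<times> transversal p"
proof -
  let ?k = "universal_part X"
  note k = partition_on_universal_part[of X]
  have 1: "X \<times> X \<subseteq> lower_edges p \<or> X \<times> X \<subseteq> upper_edges ?k" by simp
  note pk = upper_edges_part_mult[OF p k 1] lower_edges_part_mult[OF p k 1]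
    upper_trans_part_mult[OF p k 1]
  have 2: "X \<times> X \<subseteq> lower_edges (part_mult X p ?k) \<or> X \<times> X \<subseteq> upper_edges p"
    by (simp add: pk)
  \<comment> \<open>For empty \<open>X\<close> the conditional yields the empty set, which agrees
    with \<open>upper_trans p\<close> because that is a subset of \<open>X\<close>.\<close>
  have T: "upper_trans (part_mult X p ?k) = upper_trans p"
    using upper_trans_subset[OF p] by (auto simp: pk(3))
  show ?thesis
    unfolding edges_Un_transversal[OF p]
    unfolding edges_part_mult_connected[OF partition_on_part_mult p 2] pk(1) T transversal_def
    by (rule upper_square_absorb)
qed

lemma upper_trans_sandwich:
  assumes "partition_on (X <+> X) p"
  shows "upper_trans (sandwich X p) = upper_trans p"
  by (auto simp: transversal_def upper_trans_def lower_trans_def edges_sandwich[OF assms])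

text \<open>Products with the witness \<open>x = kb\<close> are bracketed to the right. This direct
  computation, using the connected upper row of \<open>kq\<close>, takes the place of
  associativity.\<close>

lemma part_mult_universal_part_mult:
  assumes p: "partition_on (X <+> X) p" and q: "partition_on (X <+> X) q"
    and ne: "lower_trans q \<noteq> {}"
  shows "edges (part_mult X p (part_mult X (universal_part X) q)) =
    map_prod Inl Inl ` upper_edges p \<union> map_prod Inr Inr ` lower_edges q \<union>
    (upper_trans p <+> lower_trans q) \<times> (upper_trans p <+> lower_trans q)"
proof -
  let ?k = "universal_part X"
  note k = partition_on_universal_part[of X]
  have 1: "X \<times> X \<subseteq> lower_edges ?k \<or> X \<times> X \<subseteq> upper_edges q" by simp
  note kq = upper_edges_part_mult[OF k q 1] lower_edges_part_mult[OF k q 1]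
    lower_trans_part_mult[OF k q 1]
  have 2: "X \<times> X \<subseteq> lower_edges p \<or> X \<times> X \<subseteq> upper_edges (part_mult X ?k q)"
    by (simp add: kq)
  have T: "lower_trans (part_mult X ?k q) = lower_trans q"
    using lower_trans_subset[OF q] ne by (auto simp: kq(3))
  show ?thesis
    unfolding edges_part_mult_connected[OF p partition_on_part_mult 2] kq(2) T
    by (rule lower_square_absorb)
qed

section \<open>The sandwich and the two orders\<close>

lemma mitsch_le_sandwich:
  assumes b: "partition_on (X <+> X) b"
  shows "mitsch_le (partition_monoid X) (sandwich X b) b"
proof (cases "lower_trans b = {}")
  case True
  then have "edges (sandwich X b) = edges b"
    using upper_trans_empty_iff[of b] by (simp add: edges_sandwich[OF b] transversal_def Plus_def)
  then have "sandwich X b = b"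
    by (rule edges_inject[OF partition_on_part_mult b])
  then show ?thesis by (simp add: mitsch_le_def)
next
  case False
  let ?k = "universal_part X" and ?c = "sandwich X b"
  \<comment> \<open>With this \<open>?y\<close>, the product of \<open>?y\<close> and
    \<open>b\<close> is literally \<open>?c\<close>; only the products of \<open>b\<close> and of
    \<open>?c\<close> with \<open>?x\<close> remain to be computed.\<close>
  let ?x = "part_mult X ?k b" and ?y = "part_mult X b ?k"
  note c = partition_on_part_mult[of X ?y b]
  note T = upper_trans_sandwich[OF b]
  have U: "upper_edges ?c = upper_edges b \<union> upper_trans b \<times> upper_trans b"
    unfolding upper_edges_def edges_sandwich[OF b] transversal_def by auto
  have bx: "edges (part_mult X b ?x) = edges ?c"
    unfolding part_mult_universal_part_mult[OF b b False] edges_sandwich[OF b]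
      edges_Un_transversal[OF b] unfolding transversal_def ..
  \<comment> \<open>\<open>?c\<close> and \<open>b\<close> have the same domain, and their kernels
    differ only by a square that is absorbed, so multiplying either by \<open>?x\<close> gives the
    same edges.\<close>
  have "edges (part_mult X ?c ?x) = edges ?c"
    unfolding bx[symmetric]
    unfolding part_mult_universal_part_mult[OF c b False]
      part_mult_universal_part_mult[OF b b False] T U
    by (rule upper_square_absorb)
  then have "?c = part_mult X ?c ?x"
    by (rule edges_inject[OF c partition_on_part_mult, OF sym])
  moreover have "?c = part_mult X b ?x"
    by (rule edges_inject[OF c partition_on_part_mult bx[symmetric]])
  moreover have "?x \<in> carrier (partition_monoid X)" "?y \<in> carrier (partition_monoid X)"
    by (simp_all add: partition_monoid_def partition_on_part_mult)
  moreover have "mult (partition_monoid X) = part_mult X"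
    by (simp add: partition_monoid_def)
  ultimately show ?thesis
    unfolding mitsch_le_def by metis
qed

text \<open>Both terms in \<open>edges_sandwich\<close>, the edge set and the square, grow with the
  edge set.\<close>

lemma edges_sandwich_mono:
  assumes p: "partition_on (X <+> X) p" and q: "partition_on (X <+> X) q"
    and "edges p \<subseteq> edges q"
  shows "edges (sandwich X p) \<subseteq> edges (sandwich X q)"
  using assms(3) transversal_mono[OF assms(3)]
  unfolding edges_sandwich[OF p] edges_sandwich[OF q] by blast

lemma edges_sandwich_mitsch:
  assumes c: "partition_on (X <+> X) c" and b: "partition_on (X <+> X) b"
    and le: "mitsch_le (partition_monoid X) c b"
  shows "edges (sandwich X c) \<subseteq> edges (sandwich X b)"
proof (cases "c = b")
  case False
  with le obtain x y where x: "c = part_mult X b x" and y: "c = part_mult X y b"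
    by (auto simp: mitsch_le_def partition_monoid_def)
  \<comment> \<open>The factorisation through \<open>x\<close> settles the vertices of the upper
    row, the one through \<open>y\<close> those of the lower row.\<close>
  have block: "(u, v) \<in> edges b" if uv: "(u, v) \<in> edges c" and u: "u \<notin> transversal b" for u v
  proof (cases u)
    case (Inl z)
    then show ?thesis
      using part_mult_upper_block[OF b, of z v x] uv u x by (auto simp: transversal_def)
  next
    case (Inr z)
    then show ?thesis
      using part_mult_lower_block[OF b, of z v y] uv u y by (auto simp: transversal_def)
  qed
  \<comment> \<open>If \<open>z\<close> were outside the domain of \<open>b\<close>, its edge to the
    lower row in \<open>c\<close> would be an edge of \<open>b\<close> and put \<open>z\<close> into
    that domain.\<close>
  have upper: "upper_trans c \<subseteq> upper_trans b"
  proof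
    fix z assume "z \<in> upper_trans c"
    then obtain w where "(Inl z, Inr w) \<in> edges c" by (auto simp: upper_trans_def)
    then show "z \<in> upper_trans b"
      using block[of "Inl z" "Inr w"] by (auto simp: transversal_def upper_trans_def)
  qed
  have lower: "lower_trans c \<subseteq> lower_trans b"
  proof
    fix z assume "z \<in> lower_trans c"
    then obtain w where "(Inr z, Inl w) \<in> edges c"
      using edges_sym[OF c] by (auto simp: lower_trans_def)
    then show "z \<in> lower_trans b"
      using block[of "Inr z" "Inl w"] edges_sym[OF b, of "Inr z" "Inl w"]
      by (auto simp: transversal_def lower_trans_def)
  qed
  \<comment> \<open>An edge that is new in \<open>c\<close> has neither end outside
    \<open>transversal b\<close>, by \<open>block\<close> applied in both directions.\<close>
  have "edges c \<subseteq> edges b \<union> transversal b \<times> transversal b"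
  proof clarify
    fix u v assume uv: "(u, v) \<in> edges c" and n: "(u, v) \<notin> edges b"
    then have "(v, u) \<in> edges c" "(v, u) \<notin> edges b"
      using edges_sym[OF b] edges_sym[OF c] by blast+
    then show "u \<in> transversal b \<and> v \<in> transversal b"
      using block uv n by blast
  qed
  moreover have "transversal c \<subseteq> transversal b"
    using upper lower by (auto simp: transversal_def)
  ultimately show ?thesis
    unfolding edges_sandwich[OF c] edges_sandwich[OF b] by blast
qed simp

theorem proposition6p6:
  fixes X :: "'a set" and a b :: "('a + 'a) set set"
  assumes "a \<in> carrier (partition_monoid X)" and "b \<in> carrier (partition_monoid X)"
  shows "(\<exists>c\<in>carrier (partition_monoid X). a \<sqsubseteq>\<^sub>e c \<and> mitsch_le (partition_monoid X) c b) \<longleftrightarrow>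
    a \<otimes>\<^bsub>partition_monoid X\<^esub> universal_part X \<otimes>\<^bsub>partition_monoid X\<^esub> a \<sqsubseteq>\<^sub>e
    b \<otimes>\<^bsub>partition_monoid X\<^esub> universal_part X \<otimes>\<^bsub>partition_monoid X\<^esub> b"
proof -
  have a: "partition_on (X <+> X) a" and b: "partition_on (X <+> X) b"
    using assms by (auto simp: partition_monoid_def)
  have "(\<exists>c. partition_on (X <+> X) c \<and> edges a \<subseteq> edges c \<and> mitsch_le (partition_monoid X) c b)
    \<longleftrightarrow> edges (sandwich X a) \<subseteq> edges (sandwich X b)"
  proof
    assume "\<exists>c. partition_on (X <+> X) c \<and> edges a \<subseteq> edges c
      \<and> mitsch_le (partition_monoid X) c b"
    \<comment> \<open>Sandwiching is monotone along each of the two relations, hence along their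
      composite.\<close>
    then show "edges (sandwich X a) \<subseteq> edges (sandwich X b)"
      using edges_sandwich_mono[OF a] edges_sandwich_mitsch[OF _ b] by (meson order_trans)
  next
    assume "edges (sandwich X a) \<subseteq> edges (sandwich X b)"
    \<comment> \<open>The witness is \<open>sandwich X b\<close>: it contains
      \<open>sandwich X a\<close>, which contains \<open>a\<close>.\<close>
    moreover have "edges a \<subseteq> edges (sandwich X a)"
      by (simp add: edges_sandwich[OF a])
    ultimately show "\<exists>c. partition_on (X <+> X) c \<and> edges a \<subseteq> edges c
      \<and> mitsch_le (partition_monoid X) c b"
      using mitsch_le_sandwich[OF b] partition_on_part_mult by blast
  qed
  then show ?thesis
    by (auto simp: subpart_def partition_monoid_def)
qed

end
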